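(* Let $p_n\in(0,1)$ and let $m_n$ be positive integers, and put $t_n=\left[\!\left[\log_{p_n}\left(\frac{m_n}{n}\right)\right]\!\right]$. Suppose one of the following holds: (1) $p_n=p$ is constant and $\lim_{n\to\infty}\frac{m_n^2}{n(\ln n)^2}=\infty$; (2) $\lim_{n\to\infty}p_n=0$ and $\lim_{n\to\infty}\frac{-(\ln p_n)\, m_n^2}{n(\ln n)^2}>4$; (3) $m_n=m$ is constant, and there are a constant integer $t$ with $t<\sqrt{2m+1}$ and a constant $b\in\left(t-1,\frac{m(t+1)}{m+t+1}\right)$ such that $p_n=n^{-1/b}$. In cases (1) and (2), $\lim_{n\to\infty}\mathbb{P}_{K\sim\Gamma_{n,m_n,p_n}}(K\in Y_{n,t_n-1})=1$. In case (3), $\lim_{n\to\infty}\mathbb{P}_{K\sim\Gamma_{n,m,p_n}}(K\in Y_{n,t-1})=1$.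
   Context: For a graph $G$ and a set $f$ of vertices, a common neighbor of $f$ is a vertex $v\notin f$ adjacent to every vertex of $f$. For a positive integer $m$, the $m$-neighbor complex $N_m(G)$ is the simplicial complex whose faces are the subsets of $V(G)$ having at least $m$ common neighbors. $G(n,p)$ is the Erdős–Rényi random graph on $[n]=\{1,\dots,n\}$ with each edge present independently with probability $p$, and $\Gamma_{n,m,p}$ is the distribution of $N_m(G)$ for $G\sim G(n,p)$. $[[y]]$ denotes an integer closest to $y$, taking the smaller one if there are two. For an integer $k$, $Y_{n,k-1}$ is the set of simplicial complexes on ground set $[n]$ that contain every subset of $[n]$ of size $k-1$ as a face and contain no face of size $k+1$. *)

theory Defs
  imports "HOL-Probability.Probability"
begin

definition all_edges :: "'a set \<Rightarrow> 'a set set" where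
  "all_edges V = {e. e \<subseteq> V \<and> card e = 2}"

text \<open>
  A simple graph is given by its vertex set \<open>V\<close> and its edge set, a subset of \<open>all_edges V\<close>.
  The random graph on \<open>{1..n}\<close> is the distribution of its edge set.
\<close>

definition random_graph :: "nat \<Rightarrow> real \<Rightarrow> nat set set pmf" where
  "random_graph n p =
     map_pmf (\<lambda>present. {e \<in> all_edges {1..n}. present e})
       (Pi_pmf (all_edges {1..n}) False (\<lambda>_. bernoulli_pmf p))"

definition common_neighbors :: "'a set \<Rightarrow> 'a set set \<Rightarrow> 'a set \<Rightarrow> 'a set" where
  "common_neighbors V E f = {v \<in> V. v \<notin> f \<and> (\<forall>u\<in>f. {u, v} \<in> E)}"

text \<open>
  A simplicial complex is represented by its set of faces, the empty set counting as a possible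
  face. Neither the empty face nor the singletons are required to be faces: for \<open>m > n\<close> a graph
  on \<open>n\<close> vertices has an \<open>m\<close>-neighbor complex without any face.
\<close>

definition simplicial_complex_on :: "'a set \<Rightarrow> 'a set set \<Rightarrow> bool" where
  "simplicial_complex_on V K \<longleftrightarrow> K \<subseteq> Pow V \<and> (\<forall>f\<in>K. \<forall>g. g \<subseteq> f \<longrightarrow> g \<in> K)"

definition neighbor_complex :: "nat \<Rightarrow> 'a set \<Rightarrow> 'a set set \<Rightarrow> 'a set set" where
  "neighbor_complex m V E = {f. f \<subseteq> V \<and> m \<le> card (common_neighbors V E f)}"

lemma simplicial_complex_neighbor_complex:
  assumes "finite V"
  shows "simplicial_complex_on V (neighbor_complex m V E)"
proof -
  have "card (common_neighbors V E f) \<le> card (common_neighbors V E g)" if "g \<subseteq> f" for f g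
    using that assms by (intro card_mono) (auto simp: common_neighbors_def)
  then show ?thesis
    unfolding simplicial_complex_on_def neighbor_complex_def by (auto intro: order_trans)
qed

definition random_neighbor_complex :: "nat \<Rightarrow> nat \<Rightarrow> real \<Rightarrow> nat set set pmf" where
  "random_neighbor_complex n m p = map_pmf (neighbor_complex m {1..n}) (random_graph n p)"

text \<open>
  The index is \<open>d = k - 1\<close>, so that \<open>Y_complexes n (k - 1)\<close> is the set \<open>Y\<close> with indices
  \<open>n\<close> and \<open>k - 1\<close>. It is an integer because \<open>k\<close> may be \<open>0\<close> or negative; there is no set of
  negative size.
\<close>

definition Y_complexes :: "nat \<Rightarrow> int \<Rightarrow> nat set set set" where
  "Y_complexes n d =
     (let k = d + 1 in
      {K. simplicial_complex_on {1..n} K \<and>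
          (\<forall>f. f \<subseteq> {1..n} \<and> int (card f) = k - 1 \<longrightarrow> f \<in> K) \<and>
          (\<forall>f\<in>K. int (card f) \<noteq> k + 1)})"

text \<open>The library's \<^const>\<open>round\<close> takes the larger of two closest integers, hence:\<close>

definition nearest_int :: "real \<Rightarrow> int" where
  "nearest_int y = Min {k. \<forall>j. \<bar>y - of_int k\<bar> \<le> \<bar>y - of_int j\<bar>}"

lemma nearest_int_eq_ceiling: "nearest_int y = \<lceil>y - 1 / 2\<rceil>"
proof -
  let ?S = "{k. \<forall>j. \<bar>y - of_int k\<bar> \<le> \<bar>y - of_int j\<bar>}"
  let ?c = "\<lceil>y - 1 / 2\<rceil>"
  have c: "of_int ?c - 1 < y - 1 / 2" "y - 1 / 2 \<le> of_int ?c"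
    by linarith+
  have c_in: "?c \<in> ?S"
  proof (intro CollectI allI)
    fix j
    have "real_of_int j \<le> of_int ?c - 1 \<or> j = ?c \<or> of_int ?c + 1 \<le> real_of_int j"
      by linarith
    with c show "\<bar>y - of_int ?c\<bar> \<le> \<bar>y - of_int j\<bar>" by linarith
  qed
  have le: "?c \<le> k \<and> k \<le> ?c + 1" if "k \<in> ?S" for k
  proof -
    have "\<bar>y - of_int k\<bar> \<le> \<bar>y - of_int (k + 1)\<bar>" "\<bar>y - of_int k\<bar> \<le> \<bar>y - of_int (k - 1)\<bar>"
      using that by blast+
    then have "y - 1 / 2 \<le> of_int k" "of_int k \<le> y + 1 / 2" by auto
    with c show ?thesis by linarith
  qed
  then have "?S \<subseteq> {?c..?c + 1}" by auto
  then have "finite ?S" by (rule finite_subset) simp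
  with c_in le show ?thesis
    unfolding nearest_int_def by (intro Min_eqI) auto
qed

end

theory Submission
  imports Defs "HOL-Real_Asymp.Real_Asymp"
begin

text \<open>
  The number \<open>X\<close> of common neighbors of a \<open>j\<close>-set is binomial with parameters \<open>n - j\<close> and \<open>p ^ j\<close>,
  so Chernoff's method bounds both tails through the expectation of \<open>s ^ X\<close>, and a union bound over
  the at most \<open>n ^ j\<close> sets of size \<open>j\<close> suffices in all three cases.

  In the first two cases put \<open>q = - ln p\<close>; it is bounded below by some \<open>q0 > 0\<close>. Since
  \<open>n p ^ x = m\<close> for \<open>x = log p (m / n)\<close>, the mean is at most \<open>m exp (- q / 2)\<close> for \<open>j = t + 1\<close> and
  almost at least \<open>m exp (q / 2)\<close> for \<open>j = t - 1\<close>. The choice \<open>s = exp (q / 2)\<close>, respectively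
  \<open>s = exp (- q / 2)\<close>, makes both tails at most \<open>exp (- k m q)\<close> with a constant \<open>k > 0\<close>. The growth
  hypothesis makes \<open>m q\<close> at least of order \<open>sqrt n ln n\<close>, which beats
  \<open>j ln n \<le> (ln n)\<^sup>2 / q0 + 3 / 2 ln n\<close>.

  In the third case, \<open>s\<close> is the inverse of the mean \<open>n p ^ (t + 1)\<close> for the faces, and \<open>1 / 2\<close> for
  the non-faces, for which the mean is a positive power of \<open>n\<close>.
\<close>

section \<open>Exponential moments of the number of common neighbors\<close>

lemma finite_all_edges: "finite V \<Longrightarrow> finite (all_edges V)"
  unfolding all_edges_def by (rule finite_subset[of _ "Pow V"]) auto

lemma finite_set_pmf_random_graph: "finite (set_pmf (random_graph n p))"
proof (rule finite_subset)
  show "set_pmf (random_graph n p) \<subseteq> Pow (all_edges {1..n})"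
    by (auto simp: random_graph_def)
qed (simp add: finite_all_edges)

text \<open>This is a product event: each edge of \<open>A\<close> contributes a factor
  \<open>p\<close>, every other edge is free.\<close>

lemma prob_random_graph_supset:
  assumes "0 \<le> p" "p \<le> 1" "A \<subseteq> all_edges {1..n}"
  shows "measure_pmf.prob (random_graph n p) {E. A \<subseteq> E} = p ^ card A"
proof -
  let ?E = "all_edges {1..n}"
  let ?B = "\<lambda>e. if e \<in> A then {True} else UNIV"
  have "measure_pmf.prob (random_graph n p) {E. A \<subseteq> E}
      = measure_pmf.prob (Pi_pmf ?E False (\<lambda>_. bernoulli_pmf p)) (Pi ?E ?B)"
    unfolding random_graph_def measure_map_pmf
    by (rule arg_cong[where f = "measure_pmf.prob _"]) (use assms(3) in \<open>auto simp: Pi_def\<close>)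
  also have "\<dots> = (\<Prod>e\<in>?E. measure_pmf.prob (bernoulli_pmf p) (?B e))"
    by (rule measure_Pi_pmf_Pi) (simp add: finite_all_edges)
  also have "\<dots> = (\<Prod>e\<in>?E. if e \<in> A then p else 1)"
    using assms(1,2) by (intro prod.cong) (auto simp: measure_pmf_single)
  also have "\<dots> = p ^ card A"
    using assms(3) by (simp add: finite_all_edges flip: prod.inter_restrict) (simp add: Int_absorb1)
  finally show ?thesis .
qed

lemma sum_Pow_power_card:
  fixes x :: "'a::comm_ring_1"
  assumes "finite A"
  shows "(\<Sum>S\<in>Pow A. x ^ card S) = (1 + x) ^ card A"
  using prod_add[OF assms, of "\<lambda>_. x" "\<lambda>_. 1"] by (simp add: add.commute)

lemma card_join_edges:
  assumes "finite f" "f \<inter> S = {}"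
  shows "card ((\<lambda>(u, v). {u, v}) ` (f \<times> S)) = card f * card S"
proof -
  have "inj_on (\<lambda>(u, v). {u, v}) (f \<times> S)"
    using assms(2) by (auto simp: inj_on_def doubleton_eq_iff)
  then show ?thesis by (simp add: card_image card_cartesian_product)
qed

text \<open>Writing \<open>s ^ card C\<close> as the sum of \<open>(s - 1) ^ card S\<close> over the subsets \<open>S\<close> of \<open>C\<close> reduces the
  expectation to the probabilities that all edges between \<open>S\<close> and \<open>f\<close> are present, so the
  distribution of the number of common neighbors is not needed.\<close>

lemma expectation_power_card_common_neighbors:
  fixes s :: real
  assumes p: "0 \<le> p" "p \<le> 1" and f: "f \<subseteq> {1..n}"
  shows "measure_pmf.expectation (random_graph n p)
           (\<lambda>E. s ^ card (common_neighbors {1..n} E f))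
         = (1 + (s - 1) * p ^ card f) ^ (n - card f)"
proof -
  let ?G = "random_graph n p"
  let ?W = "{1..n} - f"
  let ?J = "\<lambda>S. (\<lambda>(u, v). {u, v}) ` (f \<times> S)"
  have fin: "finite f" using f by (rule finite_subset) simp
  have sub: "S \<subseteq> common_neighbors {1..n} E f \<longleftrightarrow> ?J S \<subseteq> E" if "S \<subseteq> ?W" for S E
    using that by (auto simp: common_neighbors_def)
  have J: "?J S \<subseteq> all_edges {1..n}" if "S \<subseteq> ?W" for S
    using that f by (auto simp: all_edges_def card_insert_if)
  have expand: "s ^ card (common_neighbors {1..n} E f)
      = (\<Sum>S\<in>Pow ?W. (s - 1) ^ card S * indicator {E. ?J S \<subseteq> E} E)" for E
  proof -
    let ?C = "common_neighbors {1..n} E f"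
    have C: "?C \<subseteq> ?W" by (auto simp: common_neighbors_def)
    have "s ^ card ?C = (\<Sum>S\<in>Pow ?C. (s - 1) ^ card S)"
      using sum_Pow_power_card[of ?C "s - 1"] finite_subset[OF C] by simp
    also have "\<dots> = (\<Sum>S\<in>Pow ?W. (s - 1) ^ card S * indicator {E. ?J S \<subseteq> E} E)"
      using C by (intro sum.mono_neutral_cong_left) (auto simp: sub[symmetric])
    finally show ?thesis .
  qed
  have "measure_pmf.expectation ?G (\<lambda>E. s ^ card (common_neighbors {1..n} E f))
      = (\<Sum>S\<in>Pow ?W. (s - 1) ^ card S * measure_pmf.prob ?G {E. ?J S \<subseteq> E})"
    unfolding expand
    by (subst Bochner_Integration.integral_sum)
       (auto intro!: integrable_measure_pmf_finite finite_set_pmf_random_graph)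
  also have "\<dots> = (\<Sum>S\<in>Pow ?W. ((s - 1) * p ^ card f) ^ card S)"
  proof (rule sum.cong[OF refl])
    fix S assume "S \<in> Pow ?W"
    then have S: "S \<subseteq> ?W" by simp
    then have "card (?J S) = card f * card S"
      by (intro card_join_edges[OF fin]) auto
    then show "(s - 1) ^ card S * measure_pmf.prob ?G {E. ?J S \<subseteq> E}
        = ((s - 1) * p ^ card f) ^ card S"
      using prob_random_graph_supset[OF p J[OF S]] by (simp add: power_mult_distrib power_mult)
  qed
  also have "\<dots> = (1 + (s - 1) * p ^ card f) ^ (n - card f)"
    using f fin by (simp add: sum_Pow_power_card card_Diff_subset)
  finally show ?thesis .
qed

section \<open>Chernoff bounds for a single set\<close>

lemma one_plus_power_le_exp:
  fixes x :: real
  assumes "- 1 \<le> x"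
  shows "(1 + x) ^ k \<le> exp (real k * x)"
  using assms by (auto simp: exp_of_nat_mult intro!: power_mono)

lemma expectation_power_card_common_neighbors_le:
  fixes s :: real
  assumes p: "0 \<le> p" "p \<le> 1" and f: "f \<subseteq> {1..n}" and "0 \<le> s"
  shows "measure_pmf.expectation (random_graph n p)
           (\<lambda>E. s ^ card (common_neighbors {1..n} E f))
         \<le> exp (real (n - card f) * ((s - 1) * p ^ card f))"
proof -
  \<comment> \<open>This keeps the base \<open>1 + (s - 1) * p ^ card f\<close> nonnegative, so that
    \<open>1 + x \<le> exp x\<close> may be raised to a power.\<close>
  have "(1 - s) * p ^ card f \<le> 1"
    using mult_right_mono[of "1 - s" 1 "p ^ card f"] power_le_one[OF p, of "card f"] p \<open>0 \<le> s\<close>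
    by simp
  then show ?thesis
    unfolding expectation_power_card_common_neighbors[OF p f]
    by (intro one_plus_power_le_exp) (simp add: algebra_simps)
qed

text \<open>For \<open>s > 1\<close> the event says that \<open>f\<close> is a face, for \<open>s < 1\<close> it contains the event
  that \<open>f\<close> is not a face: both tails come from the same bound.\<close>

lemma prob_power_card_common_neighbors_ge_le:
  fixes s :: real
  assumes p: "0 \<le> p" "p \<le> 1" and f: "f \<subseteq> {1..n}" and s: "0 < s"
  shows "measure_pmf.prob (random_graph n p) {E. s ^ m \<le> s ^ card (common_neighbors {1..n} E f)}
         \<le> exp (real (n - card f) * ((s - 1) * p ^ card f)) / s ^ m"
proof -
  let ?G = "random_graph n p"
  have "measure_pmf.prob ?G {E \<in> space ?G. s ^ m \<le> s ^ card (common_neighbors {1..n} E f)}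
      \<le> measure_pmf.expectation ?G (\<lambda>E. s ^ card (common_neighbors {1..n} E f)) / s ^ m"
    using s by (intro integral_Markov_inequality_measure[where A = UNIV])
      (auto intro!: integrable_measure_pmf_finite finite_set_pmf_random_graph)
  also have "\<dots> \<le> exp (real (n - card f) * ((s - 1) * p ^ card f)) / s ^ m"
    using expectation_power_card_common_neighbors_le[OF p f] s by (intro divide_right_mono) auto
  finally show ?thesis by simp
qed

section \<open>Union bounds over all sets of a given size\<close>

lemma prob_ex_subset_le:
  fixes P :: "nat set \<Rightarrow> 'b \<Rightarrow> bool"
  assumes bound: "\<And>f. \<lbrakk>f \<subseteq> {1..n}; card f = j\<rbrakk> \<Longrightarrow> measure_pmf.prob M {E. P f E} \<le> B" and "0 \<le> B"
  shows "measure_pmf.prob M {E. \<exists>f. f \<subseteq> {1..n} \<and> card f = j \<and> P f E} \<le> real n ^ j * B"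
proof -
  let ?F = "{f. f \<subseteq> {1..n} \<and> card f = j}"
  have "card ?F \<le> n ^ j"
    using binomial_le_pow[of j n]
    by (cases "j \<le> n") (simp_all add: n_subsets binomial_eq_0 del: One_nat_def)
  then have card: "real (card ?F) \<le> real n ^ j" by (metis of_nat_le_iff of_nat_power)
  have "measure_pmf.prob M {E. \<exists>f. f \<subseteq> {1..n} \<and> card f = j \<and> P f E}
      = measure_pmf.prob M (\<Union>f\<in>?F. {E. P f E})"
    by (rule arg_cong[where f = "measure_pmf.prob M"]) auto
  also have "\<dots> \<le> (\<Sum>f\<in>?F. measure_pmf.prob M {E. P f E})"
    by (intro measure_pmf.finite_measure_subadditive_finite) auto
  also have "\<dots> \<le> (\<Sum>f\<in>?F. B)"
    using bound by (intro sum_mono) auto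
  also have "\<dots> \<le> real n ^ j * B"
    using card \<open>0 \<le> B\<close> by (simp add: mult_right_mono)
  finally show ?thesis .
qed

text \<open>Union bound times Chernoff bound. The number of trials \<open>n - j\<close> is rounded
  up to \<open>n\<close>, which is safe for \<open>s > 1\<close>.\<close>

definition upper_tail_bound :: "nat \<Rightarrow> nat \<Rightarrow> real \<Rightarrow> nat \<Rightarrow> real \<Rightarrow> real" where
  "upper_tail_bound n m p j s = real n ^ j * (exp (real n * p ^ j * (s - 1)) / s ^ m)"

text \<open>For \<open>s < 1\<close> rounding \<open>n - j\<close> up would be unsound, so it stays.
  The difference is real; for \<open>j > n\<close> there are no sets to bound.\<close>

definition lower_tail_bound :: "nat \<Rightarrow> nat \<Rightarrow> real \<Rightarrow> nat \<Rightarrow> real \<Rightarrow> real" where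
  "lower_tail_bound n m p j s = real n ^ j * (exp (- ((real n - real j) * p ^ j * (1 - s))) / s ^ m)"

lemma prob_ex_face_le:
  fixes s :: real
  assumes p: "0 \<le> p" "p \<le> 1" and s: "1 < s"
  shows "measure_pmf.prob (random_graph n p)
           {E. \<exists>f. f \<subseteq> {1..n} \<and> card f = j \<and> m \<le> card (common_neighbors {1..n} E f)}
         \<le> upper_tail_bound n m p j s"
  unfolding upper_tail_bound_def
proof (rule prob_ex_subset_le)
  fix f :: "nat set" assume f: "f \<subseteq> {1..n}" "card f = j"
  have "measure_pmf.prob (random_graph n p) {E. m \<le> card (common_neighbors {1..n} E f)}
      \<le> exp (real (n - card f) * ((s - 1) * p ^ card f)) / s ^ m"
    using prob_power_card_common_neighbors_ge_le[OF p f(1), of s m] s by simp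
  also have "\<dots> \<le> exp (real n * p ^ j * (s - 1)) / s ^ m"
  proof -
    have "real (n - j) * ((s - 1) * p ^ j) \<le> real n * ((s - 1) * p ^ j)"
      using p s by (intro mult_right_mono) auto
    then show ?thesis
      using s f by (intro divide_right_mono) (auto simp: mult_ac)
  qed
  finally show "measure_pmf.prob (random_graph n p) {E. m \<le> card (common_neighbors {1..n} E f)}
      \<le> exp (real n * p ^ j * (s - 1)) / s ^ m" .
qed (use s in simp)

lemma prob_ex_nonface_le:
  fixes s :: real
  assumes p: "0 \<le> p" "p \<le> 1" and s: "0 < s" "s < 1"
  shows "measure_pmf.prob (random_graph n p)
           {E. \<exists>f. f \<subseteq> {1..n} \<and> card f = j \<and> \<not> m \<le> card (common_neighbors {1..n} E f)}
         \<le> lower_tail_bound n m p j s"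
  unfolding lower_tail_bound_def
proof (rule prob_ex_subset_le)
  fix f :: "nat set" assume f: "f \<subseteq> {1..n}" "card f = j"
  then have "j \<le> n" using card_mono[of "{1..n}" f] by simp
  have "measure_pmf.prob (random_graph n p) {E. \<not> m \<le> card (common_neighbors {1..n} E f)}
      \<le> measure_pmf.prob (random_graph n p) {E. s ^ m \<le> s ^ card (common_neighbors {1..n} E f)}"
    using s by (intro measure_pmf.finite_measure_mono) (auto intro: power_decreasing)
  also have "\<dots> \<le> exp (real (n - card f) * ((s - 1) * p ^ card f)) / s ^ m"
    by (rule prob_power_card_common_neighbors_ge_le[OF p f(1) s(1)])
  also have "\<dots> = exp (- ((real n - real j) * p ^ j * (1 - s))) / s ^ m"
    using f \<open>j \<le> n\<close> by (simp add: of_nat_diff algebra_simps)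
  finally show "measure_pmf.prob (random_graph n p) {E. \<not> m \<le> card (common_neighbors {1..n} E f)}
      \<le> exp (- ((real n - real j) * p ^ j * (1 - s))) / s ^ m" .
qed (use s in simp)

text \<open>A neighbor complex can miss \<open>Y\<close> only through a face of size
  \<open>t + 1\<close> or a nonface of size \<open>t - 1\<close>. For a negative size that event is
  empty, hence the guards in \<open>U\<close> and \<open>L\<close>.\<close>

lemma prob_Y_complexes_ge:
  assumes p: "0 \<le> p" "p \<le> 1" and s: "1 < s" and r: "0 < r" "r < 1"
    and U: "0 \<le> t + 1 \<Longrightarrow> upper_tail_bound n m p (nat (t + 1)) s \<le> U" "0 \<le> U"
    and L: "0 \<le> t - 1 \<Longrightarrow> lower_tail_bound n m p (nat (t - 1)) r \<le> L" "0 \<le> L"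
  shows "1 - (U + L) \<le> measure_pmf.prob (random_neighbor_complex n m p) (Y_complexes n (t - 1))"
proof -
  let ?G = "random_graph n p"
  let ?c = "\<lambda>E f. card (common_neighbors {1..n} E f)"
  let ?U = "{E. \<exists>f. f \<subseteq> {1..n} \<and> int (card f) = t + 1 \<and> m \<le> ?c E f}"
  let ?L = "{E. \<exists>f. f \<subseteq> {1..n} \<and> int (card f) = t - 1 \<and> \<not> m \<le> ?c E f}"
  let ?Y = "{E. neighbor_complex m {1..n} E \<in> Y_complexes n (t - 1)}"
  have "measure_pmf.prob ?G ?U \<le> U"
  proof (cases "0 \<le> t + 1")
    case True
    then have "?U = {E. \<exists>f. f \<subseteq> {1..n} \<and> card f = nat (t + 1) \<and> m \<le> ?c E f}"
      by (intro Collect_cong ex_cong1) auto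
    with order_trans[OF prob_ex_face_le[OF p s] U(1)[OF True]] show ?thesis
      by simp
  next
    case False
    then have empty: "?U = {}" by auto
    show ?thesis unfolding empty using U(2) by simp
  qed
  moreover have "measure_pmf.prob ?G ?L \<le> L"
  proof (cases "0 \<le> t - 1")
    case True
    then have "?L = {E. \<exists>f. f \<subseteq> {1..n} \<and> card f = nat (t - 1) \<and> \<not> m \<le> ?c E f}"
      by (intro Collect_cong ex_cong1) auto
    with order_trans[OF prob_ex_nonface_le[OF p r] L(1)[OF True]] show ?thesis
      by simp
  next
    case False
    then have empty: "?L = {}" by auto
    show ?thesis unfolding empty using L(2) by simp
  qed
  moreover have "measure_pmf.prob ?G (- ?Y) \<le> measure_pmf.prob ?G (?U \<union> ?L)"
  proof (intro measure_pmf.finite_measure_mono subsetI)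
    fix E assume "E \<in> - ?Y"
    moreover have "simplicial_complex_on {1..n} (neighbor_complex m {1..n} E)"
      by (rule simplicial_complex_neighbor_complex) simp
    ultimately show "E \<in> ?U \<union> ?L"
      unfolding Y_complexes_def neighbor_complex_def Let_def by fastforce
  qed simp
  moreover have "measure_pmf.prob ?G (?U \<union> ?L) \<le> measure_pmf.prob ?G ?U + measure_pmf.prob ?G ?L"
    by (rule measure_Un_le) auto
  moreover have "measure_pmf.prob ?G (- ?Y) = 1 - measure_pmf.prob ?G ?Y"
    using measure_pmf.prob_compl[of ?Y ?G] by (simp add: Compl_eq_Diff_UNIV)
  ultimately show ?thesis
    by (simp add: random_neighbor_complex_def measure_map_pmf vimage_def)
qed

section \<open>Tail exponents in the first two cases\<close>

text \<open>\<open>y - 1 + exp (- y)\<close> is the Chernoff exponent per unit of \<open>m\<close>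
  for a mean \<open>m * exp (- y)\<close>. It is convex and vanishes at 0, so beyond
  \<open>y0\<close> it lies above the line through its points at 0 and \<open>y0\<close>.\<close>

lemma exp_minus_rate_ge:
  fixes y y0 :: real
  assumes "0 < y0" "y0 \<le> y"
  shows "(y0 - 1 + exp (- y0)) / y0 * y \<le> y - 1 + exp (- y)"
proof -
  have "exp (- y0) * (1 + (y0 - y)) \<le> exp (- y0) * exp (y0 - y)"
    by (intro mult_left_mono exp_ge_add_one_self) simp
  then have "exp (- y0) * (1 + (y0 - y)) \<le> exp (- y)"
    by (simp flip: exp_add)
  \<comment> \<open>The tangent at \<open>y0\<close> is at least as steep as the chord from 0 to
    \<open>y0\<close>.\<close>
  moreover have "0 \<le> (y - y0) * (1 - exp (- y0) - (y0 - 1 + exp (- y0)) / y0)"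
  proof (intro mult_nonneg_nonneg)
    have "(1 + y0) * exp (- y0) \<le> exp y0 * exp (- y0)"
      by (intro mult_right_mono exp_ge_add_one_self) simp
    then show "0 \<le> 1 - exp (- y0) - (y0 - 1 + exp (- y0)) / y0"
      using assms by (simp add: field_simps flip: exp_add)
  qed (use assms in simp)
  moreover have "(y0 - 1 + exp (- y0)) / y0 * y
      = (y0 - 1 + exp (- y0)) / y0 * (y - y0) + (y0 - 1 + exp (- y0))"
    using assms by (simp add: field_simps)
  ultimately show ?thesis
    by (simp add: algebra_simps)
qed

lemma exp_minus_rate_pos:
  fixes y :: real
  assumes "0 < y"
  shows "0 < (y - 1 + exp (- y)) / y"
  using exp_minus_greater[of y] assms by simp

text \<open>The slope exceeds 1 by a constant. In the lower tail this surplus survives the loss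
  \<open>m * y\<close> caused by dividing by \<open>s ^ m\<close>.\<close>

lemma exp_rate_ge:
  fixes y y0 :: real
  assumes "0 < y0" "y0 \<le> y"
  shows "(1 + y0 / 2) * y \<le> exp y - 1"
proof -
  have "y0 * y \<le> y\<^sup>2"
    using assms by (simp add: power2_eq_square mult_right_mono)
  with exp_lower_Taylor_quadratic[of y] assms show ?thesis
    by (simp add: algebra_simps)
qed

lemma exp_log_squared_minus_sqrt_tendsto_0:
  fixes a k :: real
  assumes "0 < a" "0 < k"
  shows "(\<lambda>n. exp ((ln (real n) / a + 3 / 2) * ln (real n) - k * (sqrt (a * real n) * ln (real n))))
    \<longlonglongrightarrow> 0"
  using assms by real_asymp

lemma power_nat_eq_exp: "0 < n \<Longrightarrow> real n ^ j = exp (real j * ln (real n))"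
  by (simp add: exp_of_nat_mult)

lemma upper_tail_bound_exp_eq:
  assumes "0 < n"
  shows "upper_tail_bound n m p j (exp y)
    = exp (real j * ln (real n) + real n * p ^ j * (exp y - 1) - real m * y)"
  using power_nat_eq_exp[OF assms]
  by (simp add: upper_tail_bound_def exp_diff exp_add exp_of_nat_mult)

lemma lower_tail_bound_exp_eq:
  assumes "0 < n"
  shows "lower_tail_bound n m p j (exp (- y))
    = exp (real j * ln (real n) - (real n - real j) * p ^ j * (1 - exp (- y)) + real m * y)"
proof -
  have "1 / exp (- y) ^ m = exp (real m * y)"
    by (simp add: exp_minus exp_of_nat_mult power_inverse divide_inverse)
  then show ?thesis
    using power_nat_eq_exp[OF assms]
    by (simp add: lower_tail_bound_def exp_diff exp_add exp_minus divide_inverse)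
qed

text \<open>Sizes are measured from the real solution \<open>x = log p (m / n)\<close> of
  \<open>n * p ^ x = m\<close>. In the third part the factor 4 in \<open>growth\<close> produces the
  square of \<open>m * q / 2\<close>.\<close>

lemma common_neighbors_scale:
  fixes p q q0 :: real
  defines "q \<equiv> - ln p"
  assumes n: "2 \<le> n" and m: "0 < m" and p: "0 < p" and q0: "0 < q0" "q0 \<le> q"
    and growth: "4 * (real n * (ln (real n))\<^sup>2) \<le> q * (real m)\<^sup>2"
  shows "real n * p ^ j = real m * exp (q * (log p (real m / real n) - real j))"
    and "log p (real m / real n) \<le> ln (real n) / q0"
    and "sqrt (q0 * real n) * ln (real n) \<le> real m * (q / 2)"
proof -
  have ln_p: "ln p = - q" by (simp add: q_def)
  have log: "log p (real m / real n) = (ln (real n) - ln (real m)) / q"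
    using n m q0 by (simp add: log_def ln_p ln_div field_simps)
  have "p ^ j = exp (real j * - q)"
    using p by (simp add: exp_of_nat_mult flip: ln_p)
  moreover have exponent: "q * (log p (real m / real n) - real j)
      = ln (real n) - ln (real m) + real j * - q"
    using q0 by (simp add: log field_simps)
  ultimately show "real n * p ^ j = real m * exp (q * (log p (real m / real n) - real j))"
    unfolding exponent using n m by (simp only: exp_diff exp_add) simp
  have "(ln (real n) - ln (real m)) / q \<le> ln (real n) / q"
    using q0 m by (intro divide_right_mono) auto
  also have "\<dots> \<le> ln (real n) / q0"
    using q0 n by (intro divide_left_mono) auto
  finally show "log p (real m / real n) \<le> ln (real n) / q0"
    by (simp add: log)
  show "sqrt (q0 * real n) * ln (real n) \<le> real m * (q / 2)"
  proof (rule power2_le_imp_le)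
    have "(sqrt (q0 * real n) * ln (real n))\<^sup>2 = q0 * (real n * (ln (real n))\<^sup>2)"
      using q0 by (simp add: power_mult_distrib)
    also have "\<dots> \<le> q * (real n * (ln (real n))\<^sup>2)"
      using q0 by (intro mult_right_mono) auto
    also have "\<dots> \<le> q * (q * (real m)\<^sup>2 / 4)"
      using growth q0 by (intro mult_left_mono) auto
    also have "\<dots> = (real m * (q / 2))\<^sup>2"
      by (simp add: power2_eq_square)
    finally show "(sqrt (q0 * real n) * ln (real n))\<^sup>2 \<le> (real m * (q / 2))\<^sup>2" .
  qed (use q0 in simp)
qed

text \<open>The parameter \<open>exp (q / 2)\<close> is \<open>m\<close> divided by the bound
  \<open>m * exp (- q / 2)\<close> on the mean, the optimal Chernoff choice for that bound.\<close>

lemma upper_tail_bound_le: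
  fixes p q q0 y0 :: real
  defines "q \<equiv> - ln p" and "y0 \<equiv> q0 / 2"
  assumes n: "2 \<le> n" and m: "0 < m" and p: "0 < p" and q0: "0 < q0" "q0 \<le> q"
    and growth: "4 * (real n * (ln (real n))\<^sup>2) \<le> q * (real m)\<^sup>2"
    and j: "log p (real m / real n) + 1 / 2 \<le> real j" "real j \<le> log p (real m / real n) + 3 / 2"
  shows "upper_tail_bound n m p j (exp (q / 2))
    \<le> exp ((ln (real n) / q0 + 3 / 2) * ln (real n)
            - (y0 - 1 + exp (- y0)) / y0 * (sqrt (q0 * real n) * ln (real n)))"
proof -
  note scale = common_neighbors_scale[of n m p q0, folded q_def, OF n m p q0 growth]
  have n_pos: "0 < n" using n by simp
  let ?y = "q / 2" and ?k = "(y0 - 1 + exp (- y0)) / y0"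
  have y: "0 < y0" "y0 \<le> ?y" using q0 by (auto simp: y0_def)
  have "q * (log p (real m / real n) - real j) \<le> q * (- (1 / 2))"
    using q0 j by (intro mult_left_mono) auto
  then have "real n * p ^ j \<le> real m * exp (- ?y)"
    using m by (simp add: scale(1))
  then have "real n * p ^ j * (exp ?y - 1) \<le> real m * exp (- ?y) * (exp ?y - 1)"
    using y by (intro mult_right_mono) auto
  also have "\<dots> = real m * (1 - exp (- ?y))"
    by (simp add: algebra_simps flip: exp_add)
  finally have mean: "real n * p ^ j * (exp ?y - 1) - real m * ?y \<le> - (real m * (?y - 1 + exp (- ?y)))"
    by (simp add: algebra_simps)
  have "?k * (sqrt (q0 * real n) * ln (real n)) \<le> ?k * (real m * ?y)"
    using scale(3) exp_minus_rate_pos[OF y(1)] by (intro mult_left_mono) auto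
  also have "\<dots> = real m * (?k * ?y)" by (simp add: mult_ac)
  also have "\<dots> \<le> real m * (?y - 1 + exp (- ?y))"
    using exp_minus_rate_ge[OF y] by (intro mult_left_mono) auto
  finally have "real n * p ^ j * (exp ?y - 1) - real m * ?y
      \<le> - (?k * (sqrt (q0 * real n) * ln (real n)))"
    using mean by linarith
  moreover have "real j * ln (real n) \<le> (ln (real n) / q0 + 3 / 2) * ln (real n)"
    using j scale(2) n by (intro mult_right_mono) auto
  ultimately show ?thesis
    unfolding upper_tail_bound_exp_eq[OF n_pos] exp_le_cancel_iff by linarith
qed

text \<open>Only \<open>n - j\<close> of the \<open>n\<close> vertices can be common neighbors. The constant in \<open>large\<close> makes
  \<open>(n - j) / n\<close> at least \<open>(1 + y0 / 4) / (1 + y0 / 2)\<close>, which uses up half of the gain from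
  \<open>exp y - 1 \<ge> (1 + y0 / 2) y\<close>.\<close>

lemma lower_tail_bound_le:
  fixes p q q0 y0 :: real
  defines "q \<equiv> - ln p" and "y0 \<equiv> q0 / 2"
  assumes n: "2 \<le> n" and m: "0 < m" and p: "0 < p" and q0: "0 < q0" "q0 \<le> q"
    and growth: "4 * (real n * (ln (real n))\<^sup>2) \<le> q * (real m)\<^sup>2"
    and large: "ln (real n) / q0 \<le> (1 - (1 + y0 / 4) / (1 + y0 / 2)) * real n"
    and j: "real j \<le> log p (real m / real n) - 1 / 2"
  shows "lower_tail_bound n m p j (exp (- (q / 2)))
    \<le> exp ((ln (real n) / q0 + 3 / 2) * ln (real n)
            - y0 / 4 * (sqrt (q0 * real n) * ln (real n)))"
proof -
  note scale = common_neighbors_scale[of n m p q0, folded q_def, OF n m p q0 growth]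
  have n_pos: "0 < n" using n by simp
  let ?y = "q / 2" and ?r = "(1 + y0 / 4) / (1 + y0 / 2)"
  have y: "0 < y0" "y0 \<le> ?y" using q0 by (auto simp: y0_def)
  have "q * (1 / 2) \<le> q * (log p (real m / real n) - real j)"
    using q0 j by (intro mult_left_mono) auto
  then have "real m * exp ?y \<le> real n * p ^ j"
    using m by (simp add: scale(1))
  moreover have "?r * real n \<le> real n - real j"
    using large j scale(2) by (simp add: algebra_simps)
  then have "?r * real n * p ^ j \<le> (real n - real j) * p ^ j"
    using p by (intro mult_right_mono) auto
  moreover have r: "0 < ?r" using y by simp
  ultimately have "?r * (real m * exp ?y) \<le> (real n - real j) * p ^ j"
    by (smt (verit, ccfv_threshold) mult.assoc mult_left_mono)
  then have tail: "?r * (real m * exp ?y) * (1 - exp (- ?y)) \<le> (real n - real j) * p ^ j * (1 - exp (- ?y))"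
    using y by (intro mult_right_mono) auto
  \<comment> \<open>The factor \<open>1 + y0 / 2\<close> cancels the denominator of
    \<open>?r\<close>; of what remains, 1 pays for \<open>m * ?y\<close> and \<open>y0 / 4\<close>
    is the decay rate.\<close>
  have "(1 + y0 / 4) * (real m * ?y) = ?r * (real m * ((1 + y0 / 2) * ?y))"
    using y by (simp add: field_simps)
  also have "\<dots> \<le> ?r * (real m * (exp ?y - 1))"
    using r exp_rate_ge[OF y] by (intro mult_left_mono) auto
  also have "real m * (exp ?y - 1) = real m * exp ?y * (1 - exp (- ?y))"
    by (simp add: algebra_simps flip: exp_add)
  also have "?r * (real m * exp ?y * (1 - exp (- ?y))) \<le> (real n - real j) * p ^ j * (1 - exp (- ?y))"
    using tail by (simp only: mult.assoc)
  finally have "real m * ?y + y0 / 4 * (real m * ?y) \<le> (real n - real j) * p ^ j * (1 - exp (- ?y))"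
    by (simp only: distrib_right mult_1)
  moreover have "y0 / 4 * (sqrt (q0 * real n) * ln (real n)) \<le> y0 / 4 * (real m * ?y)"
    using scale(3) y by (intro mult_left_mono) auto
  moreover have "real j * ln (real n) \<le> (ln (real n) / q0 + 3 / 2) * ln (real n)"
    using j scale(2) n by (intro mult_right_mono) auto
  ultimately show ?thesis
    unfolding lower_tail_bound_exp_eq[OF n_pos] exp_le_cancel_iff by linarith
qed

section \<open>Convergence in the dense and the sparse regime\<close>

lemma tendsto_prob_1I:
  assumes U: "U \<longlonglongrightarrow> 0" and L: "L \<longlonglongrightarrow> 0"
    and ge: "eventually (\<lambda>n. 1 - (U n + L n) \<le> measure_pmf.prob (M n) (A n)) sequentially"
  shows "(\<lambda>n. measure_pmf.prob (M n) (A n)) \<longlonglongrightarrow> 1"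
proof (rule tendsto_sandwich[OF ge _ _ tendsto_const])
  show "(\<lambda>n. 1 - (U n + L n)) \<longlonglongrightarrow> 1"
    using tendsto_diff[OF tendsto_const tendsto_add[OF U L], of 1] by simp
qed (simp add: measure_pmf.prob_le_1)

text \<open>Serves the first two cases at once: \<open>q0\<close> is \<open>- ln q\<close> for a
  constant \<open>p = q\<close>, and 1 for \<open>p\<close> tending to 0.\<close>

lemma prob_Y_complexes_dense_tendsto_1:
  fixes p :: "nat \<Rightarrow> real" and m :: "nat \<Rightarrow> nat"
  assumes p_range: "\<forall>n\<ge>2. 0 < p n \<and> p n < 1"
    and m_pos: "\<forall>n\<ge>2. 0 < m n"
    and q0: "0 < q0" and ev_q0: "eventually (\<lambda>n. q0 \<le> - ln (p n)) sequentially"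
    and ev_growth: "eventually (\<lambda>n. 4 * (real n * (ln (real n))\<^sup>2) \<le> - ln (p n) * (real (m n))\<^sup>2) sequentially"
  shows "(\<lambda>n. measure_pmf.prob (random_neighbor_complex n (m n) (p n))
             (Y_complexes n (nearest_int (log (p n) (real (m n) / real n)) - 1))) \<longlonglongrightarrow> 1"
proof (rule tendsto_prob_1I)
  define y0 where "y0 = q0 / 2"
  have y0: "0 < y0" using q0 by (simp add: y0_def)
  let ?B = "\<lambda>k n. exp ((ln (real n) / q0 + 3 / 2) * ln (real n) - k * (sqrt (q0 * real n) * ln (real n)))"
  let ?k = "(y0 - 1 + exp (- y0)) / y0"
  show "?B ?k \<longlonglongrightarrow> 0"
    by (rule exp_log_squared_minus_sqrt_tendsto_0[OF q0 exp_minus_rate_pos[OF y0]])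
  show "?B (y0 / 4) \<longlonglongrightarrow> 0"
    using y0 by (intro exp_log_squared_minus_sqrt_tendsto_0[OF q0]) simp
  have "0 < 1 - (1 + y0 / 4) / (1 + y0 / 2)"
    using y0 by (simp add: field_simps)
  with q0 have "eventually (\<lambda>n. ln (real n) / q0 \<le> (1 - (1 + y0 / 4) / (1 + y0 / 2)) * real n) sequentially"
    by real_asymp
  with ev_q0 ev_growth eventually_ge_at_top[of 2]
  show "eventually (\<lambda>n. 1 - (?B ?k n + ?B (y0 / 4) n) \<le>
      measure_pmf.prob (random_neighbor_complex n (m n) (p n))
        (Y_complexes n (nearest_int (log (p n) (real (m n) / real n)) - 1))) sequentially"
  proof eventually_elim
    case (elim n)
    let ?x = "log (p n) (real (m n) / real n)"
    have pn: "0 < p n" "p n < 1" and mn: "0 < m n"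
      using elim p_range m_pos by auto
    \<comment> \<open>Rounding moves \<open>?x\<close> by at most 1 / 2, so both neighbors of the
      rounded value are between 1 / 2 and 3 / 2 away from \<open>?x\<close>.\<close>
    have t: "?x - 1 / 2 \<le> of_int (nearest_int ?x)" "of_int (nearest_int ?x) \<le> ?x + 1 / 2"
      unfolding nearest_int_eq_ceiling by linarith+
    show ?case
    proof (rule prob_Y_complexes_ge)
      assume "0 \<le> nearest_int ?x + 1"
      then have "real (nat (nearest_int ?x + 1)) = of_int (nearest_int ?x) + 1" by simp
      then show "upper_tail_bound n (m n) (p n) (nat (nearest_int ?x + 1)) (exp (- ln (p n) / 2)) \<le> ?B ?k n"
        unfolding y0_def using elim pn mn q0 t by (intro upper_tail_bound_le) auto
    next
      assume "0 \<le> nearest_int ?x - 1"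
      then have "real (nat (nearest_int ?x - 1)) = of_int (nearest_int ?x) - 1" by simp
      then show "lower_tail_bound n (m n) (p n) (nat (nearest_int ?x - 1)) (exp (- (- ln (p n) / 2))) \<le> ?B (y0 / 4) n"
        unfolding y0_def using elim pn mn q0 t by (intro lower_tail_bound_le) (auto simp: y0_def)
    qed (use pn in auto)
  qed
qed

lemma prob_Y_complexes_sparse_tendsto_1:
  fixes p :: "nat \<Rightarrow> real" and t :: int and b :: real
  assumes p_eq: "\<And>n. 2 \<le> n \<Longrightarrow> p n = real n powr (- 1 / b)"
    and b_pos: "0 < b" and m: "0 < m"
    and b: "real_of_int t - 1 < b"
      "b < real m * (real_of_int t + 1) / (real m + real_of_int t + 1)"
  shows "(\<lambda>n. measure_pmf.prob (random_neighbor_complex n m (p n)) (Y_complexes n (t - 1))) \<longlonglongrightarrow> 1"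
proof (rule tendsto_prob_1I)
  \<comment> \<open>\<open>n * p ^ j\<close> is \<open>n powr (- c)\<close> for
    \<open>j = t + 1\<close> and \<open>n powr d\<close> for \<open>j = t - 1\<close>. The former to
    the power \<open>m\<close>, times the union factor \<open>n powr (t + 1)\<close>, is
    \<open>n powr (- e)\<close>.\<close>
  define c where "c = (real_of_int t + 1) / b - 1"
  define d where "d = 1 - (real_of_int t - 1) / b"
  define e where "e = real m * c - (real_of_int t + 1)"
  \<comment> \<open>\<open>0 < e\<close> is the upper bound on \<open>b\<close> with denominators
    cleared. This needs \<open>m + t + 1 > 0\<close>, which may fail for
    \<open>t + 1 < 0\<close>.\<close>
  have c: "0 < c" and e: "0 < e" if "0 \<le> t + 1"
  proof -
    have t: "0 \<le> real_of_int t + 1" using that by linarith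
    then have *: "b * (real m + real_of_int t + 1) < real m * (real_of_int t + 1)"
      using b(2) m by (simp add: pos_less_divide_eq)
    then show "0 < e"
      using b_pos by (simp add: e_def c_def field_simps)
    have "0 < real m * c"
      using \<open>0 < e\<close> t by (simp add: e_def)
    then show "0 < c"
      using m by (simp add: zero_less_mult_iff)
  qed
  have d: "0 < d"
    using b(1) b_pos by (simp add: d_def field_simps)
  let ?U = "\<lambda>n. if 0 \<le> t + 1 then exp (1 - e * ln (real n)) else 0"
  \<comment> \<open>In 1 / 4, one half comes from \<open>n - j \<ge> n / 2\<close>, the other from
    \<open>1 - s\<close> with \<open>s = 1 / 2\<close>; \<open>m * ln 2\<close> is the cost of
    \<open>s ^ m\<close>.\<close>
  let ?L = "\<lambda>n. exp ((real_of_int t - 1) * ln (real n) - 1 / 4 * real n powr d + real m * ln 2)"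
  show "?U \<longlonglongrightarrow> 0"
  proof (cases "0 \<le> t + 1")
    case True
    have "(\<lambda>n. exp (1 - e * ln (real n))) \<longlonglongrightarrow> 0"
      using e[OF True] by real_asymp
    with True show ?thesis by simp
  qed simp
  show "?L \<longlonglongrightarrow> 0"
    using d by real_asymp
  have "eventually (\<lambda>n. 2 * (real_of_int t - 1) \<le> real n) sequentially"
    by real_asymp
  with eventually_ge_at_top[of 2]
  show "eventually (\<lambda>n. 1 - (?U n + ?L n) \<le>
      measure_pmf.prob (random_neighbor_complex n m (p n)) (Y_complexes n (t - 1))) sequentially"
  proof eventually_elim
    case (elim n)
    have n_pos: "0 < n" using elim by simp
    have pn: "0 < p n" "p n < 1"
      using elim b_pos by (auto simp: p_eq powr_less_one)
    have mean: "real n * p n ^ j = real n powr (1 - real j / b)" for j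
    proof -
      have "p n ^ j = real n powr (real j * (- 1 / b))"
        using elim n_pos by (simp only: p_eq powr_power)
      then show ?thesis
        using n_pos by (simp add: powr_diff powr_minus_divide)
    qed
    \<comment> \<open>For \<open>t + 1 < 0\<close> the number \<open>c\<close> is negative and there
      is no face to exclude; the value 1 only ensures \<open>exp ?y > 1\<close>.\<close>
    let ?y = "if 0 \<le> t + 1 then c * ln (real n) else 1"
    show ?case
    proof (rule prob_Y_complexes_ge)
      assume t: "0 \<le> t + 1"
      let ?j = "nat (t + 1)"
      have j: "real ?j = real_of_int t + 1" using t by simp
      have "real n * p n ^ ?j * exp ?y = real n powr (- c) * real n powr c"
        unfolding mean j using t n_pos by (simp add: c_def powr_def)
      also have "\<dots> = 1"
        using n_pos by (simp flip: powr_add)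
      finally have "real n * p n ^ ?j * (exp ?y - 1) \<le> 1"
        using pn by (simp add: algebra_simps)
      then have "real ?j * ln (real n) + real n * p n ^ ?j * (exp ?y - 1) - real m * ?y
          \<le> 1 - e * ln (real n)"
        using t j by (simp add: e_def algebra_simps)
      then show "upper_tail_bound n m (p n) ?j (exp ?y) \<le> ?U n"
        unfolding upper_tail_bound_exp_eq[OF n_pos] using t by simp
    next
      assume t: "0 \<le> t - 1"
      let ?j = "nat (t - 1)"
      have j: "real ?j = real_of_int t - 1" using t by simp
      have "real n / 2 * p n ^ ?j \<le> (real n - real ?j) * p n ^ ?j"
        using pn elim unfolding j by (intro mult_right_mono) auto
      then have "real n powr d / 2 \<le> (real n - real ?j) * p n ^ ?j"
        using mean[of ?j] unfolding j by (simp add: d_def)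
      then show "lower_tail_bound n m (p n) ?j (exp (- ln 2)) \<le> ?L n"
        unfolding lower_tail_bound_exp_eq[OF n_pos] j by (simp add: exp_minus)
    qed (use pn c elim in auto)
  qed
qed

section \<open>Deduction of the three cases\<close>

theorem theorem1:
  fixes p :: "nat \<Rightarrow> real" and m :: "nat \<Rightarrow> nat"
  assumes p_range: "\<forall>n\<ge>2. 0 < p n \<and> p n < 1"
    and m_pos: "\<forall>n\<ge>2. 0 < m n"
  shows
    "(((\<exists>q. \<forall>n\<ge>2. p n = q) \<and>
         filterlim (\<lambda>n. (real (m n))\<^sup>2 / (real n * (ln (real n))\<^sup>2)) at_top sequentially
       \<or>
       p \<longlonglongrightarrow> 0 \<and>
         (\<exists>L::ereal. L > 4 \<and>
           (\<lambda>n. ereal (- ln (p n) * (real (m n))\<^sup>2 / (real n * (ln (real n))\<^sup>2))) \<longlonglongrightarrow> L))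
      \<longrightarrow>
      (\<lambda>n. measure_pmf.prob (random_neighbor_complex n (m n) (p n))
             (Y_complexes n (nearest_int (log (p n) (real (m n) / real n)) - 1)))
        \<longlonglongrightarrow> 1)
     \<and>
     (\<forall>(m0::nat) (t::int) (b::real).
        (\<forall>n\<ge>2. m n = m0) \<and>
        real_of_int t < sqrt (2 * real m0 + 1) \<and>
        b \<in> {real_of_int t - 1 <..<
             real m0 * (real_of_int t + 1) / (real m0 + real_of_int t + 1)} \<and>
        (\<forall>n\<ge>2. p n = real n powr (- 1 / b))
      \<longrightarrow>
      (\<lambda>n. measure_pmf.prob (random_neighbor_complex n m0 (p n)) (Y_complexes n (t - 1)))
        \<longlonglongrightarrow> 1)"
proof (intro conjI impI allI; (elim disjE conjE exE)?)
  fix q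
  assume q: "\<forall>n\<ge>2. p n = q"
    and lim: "filterlim (\<lambda>n. (real (m n))\<^sup>2 / (real n * (ln (real n))\<^sup>2)) at_top sequentially"
  have q01: "0 < - ln q"
    using p_range q by (metis ln_less_zero neg_0_less_iff_less order_refl)
  show "(\<lambda>n. measure_pmf.prob (random_neighbor_complex n (m n) (p n))
      (Y_complexes n (nearest_int (log (p n) (real (m n) / real n)) - 1))) \<longlonglongrightarrow> 1"
  proof (rule prob_Y_complexes_dense_tendsto_1[OF p_range m_pos q01])
    show "eventually (\<lambda>n. - ln q \<le> - ln (p n)) sequentially"
      using eventually_ge_at_top[of 2] by eventually_elim (use q in simp)
    \<comment> \<open>Divergence permits any constant; this one becomes 4 after multiplication by
      \<open>- ln q\<close>.\<close>
    have "eventually (\<lambda>n. 4 / - ln q \<le> (real (m n))\<^sup>2 / (real n * (ln (real n))\<^sup>2)) sequentially"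
      using lim unfolding filterlim_at_top by blast
    with eventually_ge_at_top[of 2]
    show "eventually (\<lambda>n. 4 * (real n * (ln (real n))\<^sup>2) \<le> - ln (p n) * (real (m n))\<^sup>2) sequentially"
    proof eventually_elim
      case (elim n)
      have "0 < real n * (ln (real n))\<^sup>2" using elim by simp
      then have "4 / - ln q * (real n * (ln (real n))\<^sup>2) \<le> (real (m n))\<^sup>2"
        using elim(2) by (simp only: pos_le_divide_eq)
      then have "- ln q * (4 / - ln q * (real n * (ln (real n))\<^sup>2)) \<le> - ln q * (real (m n))\<^sup>2"
        using q01 by (intro mult_left_mono) auto
      moreover have "- ln q * (4 / - ln q * x) = 4 * x" for x
        using q01 by simp
      ultimately show ?case
        using q elim(1) by simp
    qed
  qed
next
  fix L :: ereal
  assume p0: "p \<longlonglongrightarrow> 0" and L: "4 < L"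
    and lim: "(\<lambda>n. ereal (- ln (p n) * (real (m n))\<^sup>2 / (real n * (ln (real n))\<^sup>2))) \<longlonglongrightarrow> L"
  show "(\<lambda>n. measure_pmf.prob (random_neighbor_complex n (m n) (p n))
      (Y_complexes n (nearest_int (log (p n) (real (m n) / real n)) - 1))) \<longlonglongrightarrow> 1"
  proof (rule prob_Y_complexes_dense_tendsto_1[OF p_range m_pos zero_less_one])
    have "eventually (\<lambda>n. p n < exp (- 1)) sequentially"
      using p0 by (rule order_tendstoD) simp
    with eventually_ge_at_top[of 2] show "eventually (\<lambda>n. 1 \<le> - ln (p n)) sequentially"
    proof eventually_elim
      case (elim n)
      then have "ln (p n) < ln (exp (- 1))"
        using p_range by (subst ln_less_cancel_iff) auto
      then show ?case by simp
    qed
    \<comment> \<open>A limit strictly above 4, possibly infinite, keeps the sequence eventually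
      above 4.\<close>
    have "eventually (\<lambda>n. 4 < ereal (- ln (p n) * (real (m n))\<^sup>2 / (real n * (ln (real n))\<^sup>2))) sequentially"
      using lim L by (rule order_tendstoD)
    with eventually_ge_at_top[of 2]
    show "eventually (\<lambda>n. 4 * (real n * (ln (real n))\<^sup>2) \<le> - ln (p n) * (real (m n))\<^sup>2) sequentially"
    proof eventually_elim
      case (elim n)
      have "0 < real n * (ln (real n))\<^sup>2" using elim by simp
      moreover have "4 < - ln (p n) * (real (m n))\<^sup>2 / (real n * (ln (real n))\<^sup>2)"
        using elim(2) by (metis ereal_less_eq(3) not_le numeral_eq_ereal)
      ultimately show ?case
        by (simp only: pos_less_divide_eq less_imp_le)
    qed
  qed
next
  fix m0 :: nat and t :: int and b :: real
  assume m0: "\<forall>n\<ge>2. m n = m0"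
    and b: "b \<in> {real_of_int t - 1 <..<
             real m0 * (real_of_int t + 1) / (real m0 + real_of_int t + 1)}"
    and p: "\<forall>n\<ge>2. p n = real n powr (- 1 / b)"
  \<comment> \<open>\<open>0 < b\<close> is read off from \<open>p 2 < 1\<close>, which also
    excludes \<open>b = 0\<close>: there \<open>- 1 / b = 0\<close> would give
    \<open>p 2 = 1\<close>.\<close>
  have "2 powr (- 1 / b) < 1"
    using p p_range by force
  then have "- 1 / b < 0"
    using powr_less_cancel_iff[of 2 "- 1 / b" 0] by simp
  then have "0 < b" by (simp add: field_simps split: if_splits)
  moreover have "0 < m0"
    using m0 m_pos by force
  ultimately show "(\<lambda>n. measure_pmf.prob (random_neighbor_complex n m0 (p n)) (Y_complexes n (t - 1))) \<longlonglongrightarrow> 1"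
    using b p by (intro prob_Y_complexes_sparse_tendsto_1) auto
qed

end
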